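(* For every integer $n\geq 4$, $$f(n)\geq 3n+\lfloor n/2\rfloor-3 .$$
   Context: All graphs are finite and simple; a graph is nonempty if it has at least one edge. A numbering of a graph $G$ of order $n$ is a bijection $g:V(G)\to\{1,\dots,n\}$. For a nonempty graph $G$, $\mathrm{str}_g(G)=\max\{g(u)+g(v) : uv\in E(G)\}$, and the strength of $G$ is $\mathrm{str}(G)=\min\{\mathrm{str}_g(G) : g \text{ is a numbering of } G\}$. Define $f(n)=\max\{\mathrm{str}(G)+\mathrm{str}(\overline{G})\}$, where the maximum is over all graphs $G$ of order $n$ such that both $G$ and its complement $\overline{G}$ are nonempty. *)

theory Defs
  imports "HOL-Library.Ramsey"
begin

text \<open>A graph is a vertex set \<open>V\<close> with a set \<open>E\<close> of two-element subsets of \<open>V\<close>.\<close>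

definition simple_graph :: "'a set \<Rightarrow> 'a set set \<Rightarrow> bool" where
  "simple_graph V E \<longleftrightarrow> finite V \<and> E \<subseteq> [V]\<^bsup>2\<^esup>"

definition complement_edges :: "'a set \<Rightarrow> 'a set set \<Rightarrow> 'a set set" where
  "complement_edges V E = [V]\<^bsup>2\<^esup> - E"

definition numbering :: "'a set \<Rightarrow> ('a \<Rightarrow> nat) \<Rightarrow> bool" where
  "numbering V g \<longleftrightarrow> bij_betw g V {1..card V}"

definition str_wrt :: "('a \<Rightarrow> nat) \<Rightarrow> 'a set set \<Rightarrow> nat" where
  "str_wrt g E = Max {g u + g v | u v. {u, v} \<in> E}"

definition strength :: "'a set \<Rightarrow> 'a set set \<Rightarrow> nat" where
  "strength V E = Min {str_wrt g E | g. numbering V g}"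

text \<open>Vertices are natural numbers, so that the graphs of order \<open>n\<close> form a set; every finite
  graph is isomorphic to one of this kind.\<close>

definition strength_sums :: "nat \<Rightarrow> nat set" where
  "strength_sums n =
     {strength V E + strength V (complement_edges V E) | (V :: nat set) E.
        simple_graph V E \<and> card V = n \<and> E \<noteq> {} \<and> complement_edges V E \<noteq> {}}"

definition max_strength_sum :: "nat \<Rightarrow> nat" where
  "max_strength_sum n = Max (strength_sums n)"

text \<open>The sets under \<open>Max\<close> and \<open>Min\<close> above are finite and, for nonempty graphs and \<open>n \<ge> 3\<close>,
  nonempty, so these operators return a genuine maximum or minimum.\<close>

lemma simple_graph_complement:
  "simple_graph V E \<Longrightarrow> simple_graph V (complement_edges V E)"
  by (auto simp: simple_graph_def complement_edges_def)

lemma simple_graph_edgeD: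
  assumes "simple_graph V E" "{u, v} \<in> E"
  shows "u \<in> V" "v \<in> V" "u \<noteq> v"
proof -
  have "{u, v} \<in> [V]\<^bsup>2\<^esup>"
    using assms by (auto simp only: simple_graph_def)
  then show "u \<in> V" "v \<in> V" "u \<noteq> v" by simp_all
qed

lemma edge_sums_bounded:
  assumes "simple_graph V E" "numbering V g"
  shows "{g u + g v | u v. {u, v} \<in> E} \<subseteq> {..2 * card V}"
proof -
  have "g u \<le> card V" if "u \<in> V" for u
    using assms(2) that by (auto simp: numbering_def bij_betw_def)
  then have "g u + g v \<le> 2 * card V" if "{u, v} \<in> E" for u v
    using simple_graph_edgeD(1,2)[OF assms(1) that] by (metis add_mono mult_2)
  then show ?thesis by auto
qed

lemma finite_edge_sums:
  assumes "simple_graph V E" "numbering V g"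
  shows "finite {g u + g v | u v. {u, v} \<in> E}"
  using edge_sums_bounded[OF assms] finite_subset by blast

lemma edge_sums_nonempty:
  assumes "simple_graph V E" "E \<noteq> {}"
  shows "{g u + g v | u v. {u, v} \<in> E} \<noteq> {}"
proof -
  obtain e where e: "e \<in> E" using assms(2) by blast
  then have "e \<in> [V]\<^bsup>2\<^esup>" using assms(1) by (auto simp only: simple_graph_def)
  then obtain u v where "e = {u, v}" by (elim nsets2_E)
  with e show ?thesis by blast
qed

lemma str_wrt_le:
  assumes "simple_graph V E" "E \<noteq> {}" "numbering V g"
  shows "str_wrt g E \<le> 2 * card V"
proof -
  have "str_wrt g E \<in> {g u + g v | u v. {u, v} \<in> E}"
    unfolding str_wrt_def
    by (rule Max_in[OF finite_edge_sums[OF assms(1,3)] edge_sums_nonempty[OF assms(1,2)]])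
  with edge_sums_bounded[OF assms(1,3)] show ?thesis by blast
qed

lemma finite_str_wrt_values:
  assumes "simple_graph V E" "E \<noteq> {}"
  shows "finite {str_wrt g E | g. numbering V g}"
  by (rule finite_subset[of _ "{..2 * card V}"]) (use str_wrt_le[OF assms] in auto)

lemma str_wrt_values_nonempty:
  assumes "simple_graph V E"
  shows "{str_wrt g E | g. numbering V g} \<noteq> {}"
proof -
  have "\<exists>g. bij_betw g V {1..card V}"
    using assms by (intro finite_same_card_bij) (auto simp: simple_graph_def)
  then show ?thesis by (auto simp: numbering_def)
qed

lemma strength_le:
  assumes "simple_graph V E" "E \<noteq> {}"
  shows "strength V E \<le> 2 * card V"
proof -
  have "strength V E \<in> {str_wrt g E | g. numbering V g}"
    unfolding strength_def
    by (rule Min_in[OF finite_str_wrt_values[OF assms] str_wrt_values_nonempty[OF assms(1)]])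
  with str_wrt_le[OF assms] show ?thesis by auto
qed

lemma finite_strength_sums: "finite (strength_sums n)"
proof (rule finite_subset)
  show "strength_sums n \<subseteq> {..4 * n}"
  proof
    fix s assume "s \<in> strength_sums n"
    then obtain V :: "nat set" and E where
      s: "s = strength V E + strength V (complement_edges V E)" and
      G: "simple_graph V E" "card V = n" "E \<noteq> {}" "complement_edges V E \<noteq> {}"
      unfolding strength_sums_def by blast
    have "strength V E \<le> 2 * n" "strength V (complement_edges V E) \<le> 2 * n"
      using strength_le[OF G(1,3)] strength_le[OF simple_graph_complement[OF G(1)] G(4)] G(2)
      by simp_all
    with s show "s \<in> {..4 * n}" by simp
  qed
qed simp

lemma strength_sums_nonempty:
  assumes "n \<ge> 3"
  shows "strength_sums n \<noteq> {}"
proof -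
  let ?V = "{..<n}" and ?E = "{{0, 1}} :: nat set set"
  have "simple_graph ?V ?E" "card ?V = n"
    using assms by (simp_all add: simple_graph_def)
  moreover have "{0, 2} \<in> complement_edges ?V ?E"
    using assms by (auto simp: complement_edges_def doubleton_eq_iff)
  ultimately show ?thesis unfolding strength_sums_def by blast
qed

end

theory Submission
  imports Defs
begin

text \<open>The disjoint union of two cliques of sizes \<open>\<lfloor>n/2\<rfloor>\<close> and \<open>\<lceil>n/2\<rceil>\<close>,
  whose complement is complete bipartite, has a strength sum of at least
  \<open>3n + \<lfloor>n/2\<rfloor> - 3\<close>. Two features force a graph to have large strength, and each of these two
  graphs has one of them.

  The union of two cliques has no three independent vertices, so the vertices labelled
  \<open>n\<close>, \<open>n - 1\<close>, \<open>n - 2\<close> span an edge, and the strength is at least \<open>2n - 3\<close>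
  (\<open>strength_ge_independence\<close>). In the bipartite graph every vertex has degree at least
  \<open>\<lfloor>n/2\<rfloor>\<close>; the neighbours of the vertex labelled \<open>n\<close> have that many distinct positive labels,
  so the strength is at least \<open>n + \<lfloor>n/2\<rfloor>\<close> (\<open>strength_ge_min_degree\<close>). Adding the two
  bounds gives the claim.\<close>

lemma strength_geI:
  assumes G: "simple_graph V E" "E \<noteq> {}"
    and heavy: "\<And>g. numbering V g \<Longrightarrow> \<exists>u v. {u, v} \<in> E \<and> s \<le> g u + g v"
  shows "s \<le> strength V E"
proof -
  have "s \<le> str_wrt g E" if g: "numbering V g" for g
  proof -
    obtain u v where uv: "{u, v} \<in> E" "s \<le> g u + g v"
      using heavy[OF g] by blast
    have "g u + g v \<le> str_wrt g E"
      unfolding str_wrt_def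
      by (rule Max_ge[OF finite_edge_sums[OF G(1) g]]) (use uv(1) in blast)
    with uv(2) show ?thesis by simp
  qed
  then show ?thesis
    unfolding strength_def
    using Min_in[OF finite_str_wrt_values[OF G] str_wrt_values_nonempty[OF G(1)]] by auto
qed

text \<open>The vertices carrying the \<open>k + 1\<close> largest labels span an edge, and the two ends of that
  edge have distinct labels, both at least \<open>card V - k\<close>.\<close>

lemma strength_ge_independence:
  assumes G: "simple_graph V E" and k: "k < card V"
    and edge: "\<And>S. S \<subseteq> V \<Longrightarrow> card S = Suc k \<Longrightarrow> \<exists>u\<in>S. \<exists>v\<in>S. {u, v} \<in> E"
  shows "2 * (card V - k) + 1 \<le> strength V E"
proof (rule strength_geI[OF G])
  obtain S where "S \<subseteq> V" "card S = Suc k"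
    using k by (meson Suc_leI obtain_subset_with_card_n)
  then show "E \<noteq> {}" using edge by blast
next
  fix g assume "numbering V g"
  then have inj: "inj_on g V" and img: "g ` V = {1..card V}"
    by (auto simp: numbering_def bij_betw_def)
  define S where "S = {v \<in> V. card V - k \<le> g v}"
  have "g ` S = g ` V \<inter> {card V - k..}"
    by (auto simp: S_def)
  also have "\<dots> = {card V - k..card V}"
    using k by (auto simp: img)
  finally have "card (g ` S) = Suc k"
    using k by simp
  moreover have "card (g ` S) = card S"
    by (rule card_image, rule inj_on_subset[OF inj]) (auto simp: S_def)
  ultimately obtain u v where uv: "u \<in> S" "v \<in> S" "{u, v} \<in> E"
    using edge[of S] by (auto simp: S_def)
  then have "g u \<noteq> g v"
    using simple_graph_edgeD[OF G uv(3)] inj by (auto dest: inj_onD)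
  with uv show "\<exists>u v. {u, v} \<in> E \<and> 2 * (card V - k) + 1 \<le> g u + g v"
    by (intro exI[of _ u] exI[of _ v]) (auto simp: S_def)
qed

text \<open>The vertex with the largest label has \<open>d\<close> neighbours, and \<open>d\<close> distinct positive labels cannot
  all be less than \<open>d\<close>.\<close>

lemma strength_ge_min_degree:
  assumes G: "simple_graph V E" and ne: "V \<noteq> {}" and d: "0 < d"
    and deg: "\<And>u. u \<in> V \<Longrightarrow> d \<le> card {v. {u, v} \<in> E}"
  shows "card V + d \<le> strength V E"
proof (rule strength_geI[OF G])
  obtain u where "u \<in> V" using ne by blast
  then have "{v. {u, v} \<in> E} \<noteq> {}"
    using deg[of u] d by (metis card.empty not_le)
  then show "E \<noteq> {}" by blast
next
  fix g assume "numbering V g"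
  then have inj: "inj_on g V" and img: "g ` V = {1..card V}"
    by (auto simp: numbering_def bij_betw_def)
  have "card V \<in> g ` V"
    using G ne by (auto simp: img simple_graph_def card_gt_0_iff Suc_le_eq)
  then obtain u where u: "u \<in> V" "g u = card V" by auto
  let ?N = "{v. {u, v} \<in> E}"
  have N: "?N \<subseteq> V"
    using simple_graph_edgeD(2)[OF G] by blast
  have "\<exists>v\<in>?N. d \<le> g v"
  proof (rule ccontr)
    assume "\<not> ?thesis"
    then have "g ` ?N \<subseteq> {1..<d}"
      using N img by force
    then have "card (g ` ?N) \<le> d - 1"
      by (metis card_atLeastLessThan card_mono finite_atLeastLessThan)
    moreover have "card (g ` ?N) = card ?N"
      by (rule card_image[OF inj_on_subset[OF inj N]])
    ultimately show False
      using deg[OF u(1)] d by simp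
  qed
  with u show "\<exists>u v. {u, v} \<in> E \<and> card V + d \<le> g u + g v" by (metis add_left_mono mem_Collect_eq)
qed

theorem theorem3p1:
  fixes n :: nat
  assumes "n \<ge> 4"
  shows "max_strength_sum n \<ge> 3 * n + n div 2 - 3"
proof -
  define m where "m = n div 2"
  have m: "0 < m" "2 * m \<le> n" "m < n" "m + 1 < n" using assms by (auto simp: m_def)
  define V where "V = {..<n}"
  \<comment> \<open>the cliques on \<open>{..<m}\<close> and \<open>{m..<n}\<close>\<close>
  define E where "E = {e. \<exists>u v. e = {u, v} \<and> u < n \<and> v < n \<and> u \<noteq> v \<and> (u < m \<longleftrightarrow> v < m)}"
  have E_iff: "{u, v} \<in> E \<longleftrightarrow> u < n \<and> v < n \<and> u \<noteq> v \<and> (u < m \<longleftrightarrow> v < m)" for u v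
    unfolding E_def by (auto simp: doubleton_eq_iff)
  have C_iff: "{u, v} \<in> complement_edges V E \<longleftrightarrow> u < n \<and> v < n \<and> (u < m) \<noteq> (v < m)" for u v
    by (auto simp: complement_edges_def V_def E_iff)
  have G: "simple_graph V E"
    by (auto simp: simple_graph_def V_def E_def)
  have V: "card V = n" "V \<noteq> {}" using m by (auto simp: V_def)
  have "2 * (card V - 2) + 1 \<le> strength V E"
  proof (rule strength_ge_independence[OF G])
    show "2 < card V" using assms V by simp
  next
    fix S assume S: "S \<subseteq> V" "card S = Suc 2"
    then obtain x y z where "S = {x, y, z}" "x \<noteq> y" "y \<noteq> z" "x \<noteq> z"
      by (auto simp: card_Suc_eq numeral_2_eq_2)
    \<comment> \<open>two of three vertices lie in the same clique\<close>
    with S(1) show "\<exists>u\<in>S. \<exists>v\<in>S. {u, v} \<in> E"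
      by (auto simp: E_iff V_def)
  qed
  moreover have "card V + m \<le> strength V (complement_edges V E)"
  proof (rule strength_ge_min_degree[OF simple_graph_complement[OF G] V(2) m(1)])
    fix u assume "u \<in> V"
    then have "{v. {u, v} \<in> complement_edges V E} = (if u < m then {m..<n} else {..<m})"
      using m by (auto simp: C_iff) (auto simp: V_def)
    then show "m \<le> card {v. {u, v} \<in> complement_edges V E}"
      using m by (simp split: if_split) linarith
  qed
  moreover have "strength V E + strength V (complement_edges V E) \<le> max_strength_sum n"
    unfolding max_strength_sum_def
  proof (rule Max_ge[OF finite_strength_sums])
    have "{m, m + 1} \<in> E" "{0, m} \<in> complement_edges V E"
      using m by (auto simp: E_iff C_iff)
    then show "strength V E + strength V (complement_edges V E) \<in> strength_sums n"
      unfolding strength_sums_def using G V(1) by blast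
  qed
  ultimately show ?thesis
    using assms V(1) by (simp add: m_def)
qed

end
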